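(* Let $G$ be a connected graph on at least two vertices and let $\partial_2$ be the spectral gap (second smallest eigenvalue, counted with multiplicity) of its normalized distance Laplacian matrix. Then $$\partial_2\ \geq\ \frac{9-4\sqrt2}{7}.$$
   Context: Graphs are finite, simple and undirected. For a connected graph $G$ with shortest-path distance $d$, the transmission of a vertex $u$ is $t(u)=\sum_{v\in V(G)}d(u,v)$, the transmission matrix is the diagonal matrix $T=\operatorname{diag}(t(u):u\in V(G))$, and the distance matrix $\mathcal D$ has entries $\mathcal D_{u,v}=d(u,v)$. The normalized distance Laplacian is $\mathcal D^{\mathcal L}(G)=T^{-1/2}(T-\mathcal D)T^{-1/2}$, a real symmetric matrix, whose eigenvalues (with multiplicity) are denoted $0=\partial_1\le\partial_2\le\dots\le\partial_n$. *)

theory Defs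
  imports "HOL-Analysis.Analysis" "HOL-Computational_Algebra.Computational_Algebra"
begin

(* A finite graph is given by its adjacency relation on a vertex type of class finite:
   the vertex set is UNIV and the number of vertices is CARD('a). *)

definition simple_graph :: "('a \<Rightarrow> 'a \<Rightarrow> bool) \<Rightarrow> bool" where
  "simple_graph adj \<longleftrightarrow> symp adj \<and> irreflp adj"

definition connected_graph :: "('a \<Rightarrow> 'a \<Rightarrow> bool) \<Rightarrow> bool" where
  "connected_graph adj \<longleftrightarrow> (\<forall>u v. rtranclp adj u v)"

(* (adj ^^ k) u v says that there is a walk of length k from u to v.  The value is
   meaningful only when v is reachable from u. *)
definition graph_dist :: "('a \<Rightarrow> 'a \<Rightarrow> bool) \<Rightarrow> 'a \<Rightarrow> 'a \<Rightarrow> nat" where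
  "graph_dist adj u v = (LEAST k. (adj ^^ k) u v)"

definition transmission :: "('a::finite \<Rightarrow> 'a \<Rightarrow> bool) \<Rightarrow> 'a \<Rightarrow> nat" where
  "transmission adj u = (\<Sum>v\<in>UNIV. graph_dist adj u v)"

definition diag_matrix :: "('n::finite \<Rightarrow> real) \<Rightarrow> real ^ 'n ^ 'n" where
  "diag_matrix f = (\<chi> i j. if i = j then f i else 0)"

definition transmission_matrix :: "('a::finite \<Rightarrow> 'a \<Rightarrow> bool) \<Rightarrow> real ^ 'a ^ 'a" where
  "transmission_matrix adj = diag_matrix (\<lambda>u. real (transmission adj u))"

definition distance_matrix :: "('a::finite \<Rightarrow> 'a \<Rightarrow> bool) \<Rightarrow> real ^ 'a ^ 'a" where
  "distance_matrix adj = (\<chi> u v. real (graph_dist adj u v))"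

(* In a connected graph on at least two vertices every transmission is positive, so the
   entries of the inverse square root of the transmission matrix are genuine reciprocals. *)
definition transmission_inv_sqrt :: "('a::finite \<Rightarrow> 'a \<Rightarrow> bool) \<Rightarrow> real ^ 'a ^ 'a" where
  "transmission_inv_sqrt adj = diag_matrix (\<lambda>u. 1 / sqrt (real (transmission adj u)))"

definition normalized_distance_laplacian :: "('a::finite \<Rightarrow> 'a \<Rightarrow> bool) \<Rightarrow> real ^ 'a ^ 'a" where
  "normalized_distance_laplacian adj =
     transmission_inv_sqrt adj ** (transmission_matrix adj - distance_matrix adj)
       ** transmission_inv_sqrt adj"

definition charpoly :: "real ^ 'n ^ 'n \<Rightarrow> real poly" where
  "charpoly A = det (\<chi> i j. (if i = j then [:0, 1:] else 0) - [:A $ i $ j:])"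

(* The real eigenvalues, repeated according to algebraic multiplicity and in increasing
   order.  For a real symmetric matrix all complex eigenvalues are real, so the list
   has length CARD('n). *)
definition eigenvalue_list :: "real ^ 'n ^ 'n \<Rightarrow> real list" where
  "eigenvalue_list A = sorted_list_of_multiset (proots (charpoly A))"

(* The second smallest eigenvalue; list positions are counted from 0. *)
definition ndl_spectral_gap :: "('a::finite \<Rightarrow> 'a \<Rightarrow> bool) \<Rightarrow> real" where
  "ndl_spectral_gap adj = eigenvalue_list (normalized_distance_laplacian adj) ! 1"

end

(* Only the metric axioms for d are used, and they give the stronger bound 1/2.  Let the f_u
   sum to 0 and split f = p - q into positive and negative parts, of common total F.  With
   A = sum d(u,v) p_u p_v, B = sum d(u,v) q_u q_v and X = sum d(u,v) p_u q_v, averaging the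
   triangle inequality d(u,v) <= d(u,w) + d(w,v) over w with weights q_w / F gives A <= 2 X,
   and likewise B <= 2 X.  Hence the form of the distance matrix at f is
   A + B - 2 X <= (A + B) / 2, and A + B <= sum t(u) f_u^2 since
   2 p_u p_v <= p_u^2 + p_v^2.  The vectors T^(1/2) f fill a hyperplane, so Courant-Fischer
   turns this into the bound 1/2 <= second eigenvalue. *)

theory Submission
  imports Defs
begin

section \<open>Quadratic forms of finite metrics\<close>

lemma bilinear_sum_le_via_triangle:
  fixes d :: "'a::finite \<Rightarrow> 'a \<Rightarrow> real"
  assumes sym: "\<And>u v. d u v = d v u" and tri: "\<And>u v w. d u v \<le> d u w + d w v"
    and p: "\<And>u. p u \<ge> 0" and q: "\<And>u. q u \<ge> 0"
    and eq: "sum p UNIV = sum q UNIV" and pos: "sum p UNIV > 0"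
  shows "(\<Sum>u\<in>UNIV. \<Sum>v\<in>UNIV. d u v * p u * p v) \<le> 2 * (\<Sum>u\<in>UNIV. \<Sum>v\<in>UNIV. d u v * p u * q v)"
proof -
  define F where "F = sum p UNIV"
  define X where "X = (\<Sum>u\<in>UNIV. \<Sum>v\<in>UNIV. d u v * p u * q v)"
  have Fq: "F = sum q UNIV" using eq F_def by simp
  \<comment> \<open>Multiplying by \<open>F\<close>, written as the total of \<open>q\<close>,
    inserts the intermediate point \<open>w\<close> without any division by
    \<open>F\<close>.\<close>
  have "F * (\<Sum>u\<in>UNIV. \<Sum>v\<in>UNIV. d u v * p u * p v)
      = (\<Sum>u\<in>UNIV. \<Sum>v\<in>UNIV. \<Sum>w\<in>UNIV. (p u * p v * q w) * d u v)"
    by (simp add: Fq sum_distrib_left sum_distrib_right mult_ac)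
  also have "\<dots> \<le> (\<Sum>u\<in>UNIV. \<Sum>v\<in>UNIV. \<Sum>w\<in>UNIV. (p u * p v * q w) * (d u w + d w v))"
    by (intro sum_mono mult_left_mono tri mult_nonneg_nonneg p q)
  also have "\<dots> = (\<Sum>u\<in>UNIV. \<Sum>v\<in>UNIV. \<Sum>w\<in>UNIV. p v * (d u w * p u * q w))
      + (\<Sum>u\<in>UNIV. \<Sum>v\<in>UNIV. \<Sum>w\<in>UNIV. p u * (d v w * p v * q w))"
    by (simp add: sum.distrib distrib_left mult_ac sym)
  \<comment> \<open>In each half of the detour one endpoint does not occur in the distance; summing
    its weight gives \<open>F\<close> and leaves \<open>X\<close>.\<close>
  also have "(\<Sum>u\<in>UNIV. \<Sum>v\<in>UNIV. \<Sum>w\<in>UNIV. p v * (d u w * p u * q w)) = F * X"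
    by (subst sum.swap) (simp add: F_def X_def sum_distrib_left[symmetric] sum_distrib_right[symmetric])
  also have "(\<Sum>u\<in>UNIV. \<Sum>v\<in>UNIV. \<Sum>w\<in>UNIV. p u * (d v w * p v * q w)) = F * X"
    by (simp add: F_def X_def sum_distrib_left[symmetric] sum_distrib_right[symmetric])
  finally have "F * (\<Sum>u\<in>UNIV. \<Sum>v\<in>UNIV. d u v * p u * p v) \<le> F * (2 * X)" by simp
  then show ?thesis using pos by (simp add: F_def X_def)
qed

text \<open>Weight \<open>2 * p u * p v \<le> (p u)\<^sup>2 + (p v)\<^sup>2\<close> by
  \<open>d u v\<close> and sum: by symmetry of \<open>d\<close> both squares contribute the same
  total.\<close>

lemma quadratic_sum_le:
  fixes d :: "'a::finite \<Rightarrow> 'a \<Rightarrow> real"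
  assumes sym: "\<And>u v. d u v = d v u" and nn: "\<And>u v. d u v \<ge> 0"
  shows "(\<Sum>u\<in>UNIV. \<Sum>v\<in>UNIV. d u v * p u * p v) \<le> (\<Sum>u\<in>UNIV. (\<Sum>v\<in>UNIV. d u v) * (p u)\<^sup>2)"
proof -
  let ?T = "\<Sum>u\<in>UNIV. \<Sum>v\<in>UNIV. d u v * (p u)\<^sup>2"
  have "2 * (d u v * p u * p v) \<le> d u v * (p u)\<^sup>2 + d u v * (p v)\<^sup>2" for u v
    using mult_left_mono[OF sum_squares_bound[of "p u" "p v"] nn[of u v]]
    by (simp add: algebra_simps)
  then have "2 * (\<Sum>u\<in>UNIV. \<Sum>v\<in>UNIV. d u v * p u * p v)
      \<le> (\<Sum>u\<in>UNIV. \<Sum>v\<in>UNIV. d u v * (p u)\<^sup>2 + d u v * (p v)\<^sup>2)"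
    unfolding sum_distrib_left by (intro sum_mono)
  also have "\<dots> = ?T + (\<Sum>u\<in>UNIV. \<Sum>v\<in>UNIV. d u v * (p v)\<^sup>2)"
    by (simp add: sum.distrib)
  also have "(\<Sum>u\<in>UNIV. \<Sum>v\<in>UNIV. d u v * (p v)\<^sup>2) = ?T"
    by (subst sum.swap) (simp only: sym)
  finally show ?thesis by (simp add: sum_distrib_right)
qed

lemma metric_quadratic_form_le:
  fixes d :: "'a::finite \<Rightarrow> 'a \<Rightarrow> real"
  assumes sym: "\<And>u v. d u v = d v u" and tri: "\<And>u v w. d u v \<le> d u w + d w v"
    and nn: "\<And>u v. d u v \<ge> 0" and f0: "sum f UNIV = 0"
  shows "(\<Sum>u\<in>UNIV. \<Sum>v\<in>UNIV. d u v * f u * f v) \<le> (\<Sum>u\<in>UNIV. (\<Sum>v\<in>UNIV. d u v) * (f u)\<^sup>2) / 2"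
proof -
  define p where "p u = max (f u) 0" for u
  define q where "q u = max (- f u) 0" for u
  have f: "f u = p u - q u" for u by (simp add: p_def q_def)
  \<comment> \<open>The cross term vanishes because \<open>p\<close> and \<open>q\<close> have
    disjoint supports.\<close>
  have f2: "(f u)\<^sup>2 = (p u)\<^sup>2 + (q u)\<^sup>2" for u by (simp add: p_def q_def max_def)
  have p: "p u \<ge> 0" and q: "q u \<ge> 0" for u by (simp_all add: p_def q_def)
  have eq: "sum p UNIV = sum q UNIV" using f0 by (simp add: f sum_subtractf)
  show ?thesis
  proof (cases "sum p UNIV > 0")
    \<comment> \<open>The averaging estimate requires a positive total; total zero forces
      \<open>f\<close> to vanish identically.\<close>
    case False
    moreover have "sum p UNIV \<ge> 0" by (intro sum_nonneg p)
    ultimately have "sum p UNIV = 0" by simp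
    with eq p q have "p u = 0" "q u = 0" for u by (simp_all add: sum_nonneg_eq_0_iff)
    then show ?thesis by (simp add: f)
  next
    case True
    define B where "B g h = (\<Sum>u\<in>UNIV. \<Sum>v\<in>UNIV. d u v * g u * h v)" for g h
    define T where "T g = (\<Sum>u\<in>UNIV. (\<Sum>v\<in>UNIV. d u v) * (g u)\<^sup>2)" for g
    have swap: "B q p = B p q"
      unfolding B_def by (subst sum.swap) (simp only: sym mult_ac)
    have "B f f = B p p + B q q - B p q - B q p"
      by (simp add: B_def f algebra_simps sum.distrib sum_subtractf)
    moreover have "B p p \<le> 2 * B p q" unfolding B_def
      by (rule bilinear_sum_le_via_triangle[OF sym tri p q eq True])
    moreover have "B q q \<le> 2 * B q p" unfolding B_def
      using True eq by (intro bilinear_sum_le_via_triangle[OF sym tri q p]) auto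
    moreover have "B p p \<le> T p" "B q q \<le> T q"
      unfolding B_def T_def by (rule quadratic_sum_le[OF sym nn])+
    moreover have "T f = T p + T q"
      by (simp add: T_def f2 distrib_left sum.distrib)
    ultimately have "B f f \<le> T f / 2" using swap by simp
    then show ?thesis by (simp add: B_def T_def)
  qed
qed

section \<open>Diagonalization of real symmetric matrices\<close>

text \<open>By compactness the form \<open>x \<bullet> f x\<close> has a maximizer on the unit
  sphere of \<open>V\<close>. First-order variation along the residual
  \<open>f x - l *\<^sub>R x\<close>, which stays in \<open>V\<close>, shows that the residual is
  zero.\<close>

lemma exists_eigenvector_on_invariant_subspace:
  fixes f :: "'a::euclidean_space \<Rightarrow> 'a"
  assumes lin: "linear f" and self: "\<And>x y. f x \<bullet> y = x \<bullet> f y"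
    and V: "subspace V" and inv: "f ` V \<subseteq> V" and ne: "V \<noteq> {0}"
  shows "\<exists>x\<in>V. norm x = 1 \<and> (\<exists>l. f x = l *\<^sub>R x)"
proof -
  have contf: "continuous_on S f" for S
    using lin by (simp add: linear_continuous_on linear_linear)
  let ?S = "V \<inter> sphere 0 1"
  have "compact ?S"
    using V by (intro closed_Int_compact closed_subspace) auto
  moreover obtain y where y: "y \<in> V" "y \<noteq> 0" using ne subspace_0[OF V] by auto
  then have "y /\<^sub>R norm y \<in> ?S" using V by (simp add: subspace_scale)
  then have "?S \<noteq> {}" by blast
  moreover have "continuous_on ?S (\<lambda>x. x \<bullet> f x)" by (intro continuous_intros contf)
  ultimately obtain x where x: "x \<in> ?S" and max: "\<And>y. y \<in> ?S \<Longrightarrow> y \<bullet> f y \<le> x \<bullet> f x"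
    using continuous_attains_sup[of ?S "\<lambda>x. x \<bullet> f x"] by blast
  define l where "l = x \<bullet> f x"
  \<comment> \<open>Homogeneity carries the maximum from the sphere to all of
    \<open>V\<close>.\<close>
  have le: "y \<bullet> f y \<le> l * (y \<bullet> y)" if "y \<in> V" for y
  proof (cases "y = 0")
    case True then show ?thesis by simp
  next
    case False
    then have "y /\<^sub>R norm y \<in> ?S" using V that by (simp add: subspace_scale)
    from max[OF this] have "(y \<bullet> f y) / (norm y)\<^sup>2 \<le> l"
      using lin by (simp add: l_def linear_scale power2_eq_square divide_inverse mult_ac)
    then show ?thesis using False by (simp add: divide_le_eq dot_square_norm)
  qed
  define z where "z = f x - l *\<^sub>R x"
  have zV: "z \<in> V"
    unfolding z_def using V inv x by (intro subspace_diff subspace_scale) auto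
  define K where "K = z \<bullet> f z - l * (z \<bullet> z)"
  have xx: "x \<bullet> x = 1" using x by (simp add: dot_square_norm)
  \<comment> \<open>Apply \<open>le\<close> to \<open>x + s *\<^sub>R z\<close>: the constant terms
    and the multiples of \<open>z \<bullet> x\<close> cancel.\<close>
  have key: "2 * s * (z \<bullet> z) + s\<^sup>2 * K \<le> 0" for s
  proof -
    have "x + s *\<^sub>R z \<in> V" using V x zV by (intro subspace_add subspace_scale) auto
    from le[OF this] have "(x + s *\<^sub>R z) \<bullet> (f x + s *\<^sub>R f z) \<le> l * ((x + s *\<^sub>R z) \<bullet> (x + s *\<^sub>R z))"
      using lin by (simp add: linear_add linear_scale)
    moreover have "x \<bullet> f z = z \<bullet> f x" using self[of x z] by (simp add: inner_commute)
    moreover have "z \<bullet> f x = z \<bullet> z + l * (z \<bullet> x)" by (simp add: z_def inner_diff_right)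
    ultimately show ?thesis
      by (simp add: inner_add_left inner_add_right K_def power2_eq_square xx l_def[symmetric]
          inner_commute[of x z] algebra_simps)
  qed
  have "z \<bullet> z = 0"
  proof (rule ccontr)
    assume "z \<bullet> z \<noteq> 0"
    then have zz: "z \<bullet> z > 0" by simp
    \<comment> \<open>Small enough that \<open>s * \<bar>K\<bar> \<le> z \<bullet> z\<close>, so the
      linear term wins; the added 1 keeps the denominator positive.\<close>
    define s where "s = (z \<bullet> z) / (1 + \<bar>K\<bar>)"
    have s: "s > 0" using zz by (simp add: s_def)
    have "s * (2 * (z \<bullet> z) + s * K) \<le> 0"
      using key[of s] by (simp add: power2_eq_square algebra_simps)
    with s have "2 * (z \<bullet> z) + s * K \<le> 0" by (simp add: mult_le_0_iff)
    moreover have "s * \<bar>K\<bar> \<le> z \<bullet> z"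
      using zz by (simp add: s_def field_simps)
    moreover have "- (s * K) \<le> s * \<bar>K\<bar>" using s by (simp add: abs_if)
    ultimately show False using zz by linarith
  qed
  then have "f x = l *\<^sub>R x" by (simp add: z_def)
  then show ?thesis using x by auto
qed

text \<open>Take an orthonormal set of eigenvectors of maximal size. Its orthogonal complement is
  invariant by self-adjointness, so if it were nonzero it would contain a further unit
  eigenvector.\<close>

lemma exists_orthonormal_eigenbasis:
  fixes f :: "'a::euclidean_space \<Rightarrow> 'a"
  assumes lin: "linear f" and self: "\<And>x y. f x \<bullet> y = x \<bullet> f y"
  shows "\<exists>B. card B = DIM('a) \<and> pairwise orthogonal B \<and> (\<forall>b\<in>B. norm b = 1 \<and> (\<exists>l. f b = l *\<^sub>R b))"
proof -
  define E where "E = {b. norm b = 1 \<and> (\<exists>l. f b = l *\<^sub>R b)}"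
  let ?P = "\<lambda>B. finite B \<and> pairwise orthogonal B \<and> B \<subseteq> E"
  have indep: "independent B" if "?P B" for B
  proof -
    have "0 \<notin> B" using that by (auto simp: E_def)
    then show ?thesis by (rule pairwise_orthogonal_independent[rotated]) (use that in simp)
  qed
  have bound: "card B \<le> DIM('a)" if "?P B" for B
    using independent_bound[OF indep[OF that]] by simp
  have "?P {}" by simp
  moreover have "\<forall>B. ?P B \<longrightarrow> card B < Suc (DIM('a))" using bound by (simp add: less_Suc_eq_le)
  ultimately have "\<exists>B. ?P B \<and> (\<forall>C. ?P C \<longrightarrow> card C \<le> card B)"
    by (rule ex_has_greatest_nat)
  then obtain B where B: "?P B" and max: "\<And>C. ?P C \<Longrightarrow> card C \<le> card B" by blast
  define V where "V = {x. \<forall>b\<in>B. orthogonal b x}"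
  have sub: "subspace V"
    unfolding V_def by (auto simp: subspace_def orthogonal_clauses)
  have inv: "f ` V \<subseteq> V"
  proof (clarsimp simp: V_def orthogonal_def)
    fix x b assume x: "\<forall>b\<in>B. b \<bullet> x = 0" and b: "b \<in> B"
    obtain l where "f b = l *\<^sub>R b" using B b unfolding E_def by blast
    then have "f b \<bullet> x = 0" using x b by simp
    then show "b \<bullet> f x = 0" by (simp add: self)
  qed
  have "V = {0}"
  proof (rule ccontr)
    assume "V \<noteq> {0}"
    from exists_eigenvector_on_invariant_subspace[OF lin self sub inv this]
    obtain x where x: "x \<in> V" "norm x = 1" "\<exists>l. f x = l *\<^sub>R x" by blast
    have "x \<notin> B"
    proof
      assume "x \<in> B"
      then have "x \<bullet> x = 0" using x by (auto simp: V_def orthogonal_def)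
      then show False using x by simp
    qed
    moreover have "?P (insert x B)"
      using B x by (auto simp: pairwise_insert V_def E_def orthogonal_commute)
    ultimately show False using max[of "insert x B"] B by simp
  qed
  have "span B = UNIV"
  proof (rule ccontr)
    assume "span B \<noteq> UNIV"
    then obtain a where "a \<noteq> 0" "\<forall>x\<in>span B. a \<bullet> x = 0"
      using span_not_UNIV_orthogonal by blast
    then have "a \<in> V" by (auto simp: V_def orthogonal_def inner_commute span_base)
    with \<open>V = {0}\<close> \<open>a \<noteq> 0\<close> show False by simp
  qed
  then have "card B = DIM('a)"
    using indep[OF B] by (metis dim_UNIV dim_span_eq_card_independent dim_eq_card_independent dim_span)
  then show ?thesis using B unfolding E_def by blast
qed

text \<open>Spectral theorem with the basis indexed by \<open>'n\<close>, so that its members can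
  serve as the columns of a square matrix.\<close>

lemma symmetric_matrix_orthonormal_eigenvectors:
  fixes A :: "real ^ 'n ^ 'n"
  assumes "transpose A = A"
  shows "\<exists>(b :: 'n \<Rightarrow> real ^ 'n) l. (\<forall>i j. b i \<bullet> b j = (if i = j then 1 else 0)) \<and> (\<forall>i. A *v b i = l i *\<^sub>R b i)"
proof -
  have self: "(A *v x) \<bullet> y = x \<bullet> (A *v y)" for x y
    using assms by (metis dot_lmul_matrix vector_transpose_matrix)
  obtain B where B: "card B = DIM(real^'n)" "pairwise orthogonal B"
    "\<And>b. b \<in> B \<Longrightarrow> norm b = 1 \<and> (\<exists>l. A *v b = l *\<^sub>R b)"
    using exists_orthonormal_eigenbasis[OF matrix_vector_mul_linear[of A] self] by blast
  have "finite B" using B(1) by (metis DIM_positive card.infinite less_irrefl)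
  then obtain b where b: "bij_betw b (UNIV :: 'n set) B"
    using finite_same_card_bij[of "UNIV :: 'n set" B] B(1) by auto
  have bB: "b i \<in> B" for i using b by (auto simp: bij_betw_def)
  have "b i \<bullet> b j = (if i = j then 1 else 0)" for i j
  proof (cases "i = j")
    case True then show ?thesis using B(3)[OF bB] by (simp add: dot_square_norm)
  next
    case False
    then have "b i \<noteq> b j" using b by (auto simp: bij_betw_def inj_on_def)
    then show ?thesis using False B(2) bB by (auto simp: pairwise_def orthogonal_def)
  qed
  moreover have "A *v b i = (SOME l. A *v b i = l *\<^sub>R b i) *\<^sub>R b i" for i
    using someI_ex[of "\<lambda>l. A *v b i = l *\<^sub>R b i"] B(3)[OF bB] by blast
  ultimately show ?thesis
    by (intro exI[of _ b] exI[of _ "\<lambda>i. SOME l. A *v b i = l *\<^sub>R b i"]) blast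
qed

section \<open>Characteristic polynomial and the list of eigenvalues\<close>

text \<open>The embedding into polynomial matrices is multiplicative, so a similarity over the reals
  can be used inside the determinant that defines \<open>charpoly\<close>.\<close>

definition const_poly_matrix :: "real ^ 'n ^ 'm \<Rightarrow> real poly ^ 'n ^ 'm" where
  "const_poly_matrix A = (\<chi> i j. [:A $ i $ j:])"

lemma const_poly_sum: "[:sum f S:] = (\<Sum>i\<in>S. [:f i:])"
proof (induction S rule: infinite_finite_induct)
  case (insert x F)
  then show ?case by (simp flip: insert.IH)
qed simp_all

lemma const_poly_matrix_mult:
  "const_poly_matrix (A ** B) = const_poly_matrix A ** const_poly_matrix B"
  by (simp add: const_poly_matrix_def matrix_matrix_mult_def vec_eq_iff const_poly_sum mult.commute)

lemma const_poly_matrix_one: "const_poly_matrix (mat 1) = mat 1"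
  by (simp add: const_poly_matrix_def mat_def vec_eq_iff)

text \<open>With the eigenvectors as columns of \<open>Q\<close> and the eigenvalues on the diagonal
  of \<open>L\<close>, \<open>A ** Q = Q ** L\<close>; hence the characteristic matrices of
  \<open>A\<close> and \<open>L\<close> are similar and share their determinant.\<close>

lemma charpoly_eq_prod:
  fixes A :: "real ^ 'n ^ 'n" and b :: "'n \<Rightarrow> real ^ 'n"
  assumes on: "\<And>i j. b i \<bullet> b j = (if i = j then 1 else 0)"
    and ev: "\<And>i. A *v b i = l i *\<^sub>R b i"
  shows "charpoly A = (\<Prod>i\<in>UNIV. [:- l i, 1:])"
proof -
  define Q :: "real ^ 'n ^ 'n" where "Q = (\<chi> i j. b j $ i)"
  define L :: "real ^ 'n ^ 'n" where "L = (\<chi> i j. if i = j then l i else 0)"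
  have QtQ: "transpose Q ** Q = mat 1"
    using on by (simp add: vec_eq_iff matrix_matrix_mult_def mat_def transpose_def Q_def inner_vec_def)
  have AQ: "A ** Q = Q ** L"
  proof -
    have "(A ** Q) $ i $ j = (Q ** L) $ i $ j" for i j
    proof -
      have "(A ** Q) $ i $ j = (A *v b j) $ i"
        by (simp add: matrix_matrix_mult_def matrix_vector_mult_def Q_def)
      also have "\<dots> = l j * b j $ i" by (simp add: ev)
      also have "\<dots> = (Q ** L) $ i $ j"
        by (simp add: matrix_matrix_mult_def Q_def L_def if_distrib cong: if_cong)
      finally show ?thesis .
    qed
    then show ?thesis by (simp add: vec_eq_iff)
  qed
  let ?c = "const_poly_matrix :: real^'n^'n \<Rightarrow> _"
  let ?X = "mat [:0, 1:] :: real poly ^ 'n ^ 'n"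
  let ?M = "?X - ?c A"
  let ?D = "?X - ?c L"
  have scal: "?X ** M = M ** ?X" for M :: "real poly ^ 'n ^ 'n"
    by (simp add: vec_eq_iff matrix_matrix_mult_def mat_def if_distrib if_distribR mult.commute cong: if_cong)
  have "?M ** ?c Q = ?c Q ** ?D"
  proof -
    have "?M ** ?c Q = ?X ** ?c Q - ?c (A ** Q)"
      unfolding const_poly_matrix_mult
      by (simp add: vec_eq_iff matrix_matrix_mult_def sum_subtractf left_diff_distrib)
    also have "\<dots> = ?c Q ** ?X - ?c Q ** ?c L"
      by (simp add: scal AQ const_poly_matrix_mult)
    also have "\<dots> = ?c Q ** ?D"
      by (simp add: vec_eq_iff matrix_matrix_mult_def sum_subtractf right_diff_distrib)
    finally show ?thesis .
  qed
  then have "det ?M * det (?c Q) = det (?c Q) * det ?D"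
    by (metis det_mul)
  \<comment> \<open>Orthogonality of \<open>Q\<close> makes its determinant nonzero, so it cancels
    in the integral domain of polynomials.\<close>
  moreover have "det (?c (transpose Q)) * det (?c Q) = 1"
    by (metis QtQ const_poly_matrix_mult const_poly_matrix_one det_I det_mul)
  then have "det (?c Q) \<noteq> 0" by auto
  ultimately have "det ?M = det ?D" by simp
  moreover have "charpoly A = det ?M"
    unfolding charpoly_def by (rule arg_cong[where f = det]) (simp add: vec_eq_iff mat_def const_poly_matrix_def)
  moreover have "det ?D = (\<Prod>i\<in>UNIV. ?D $ i $ i)"
    by (rule det_diagonal) (simp add: mat_def const_poly_matrix_def L_def)
  ultimately show ?thesis
    by (simp add: mat_def const_poly_matrix_def L_def)
qed

text \<open>Each linear factor of the characteristic polynomial contributes one root, so repeated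
  values of \<open>l\<close> keep their multiplicity.\<close>

lemma eigenvalue_list_eq:
  fixes A :: "real ^ 'n ^ 'n" and b :: "'n \<Rightarrow> real ^ 'n"
  assumes "\<And>i j. b i \<bullet> b j = (if i = j then 1 else 0)" and "\<And>i. A *v b i = l i *\<^sub>R b i"
  shows "eigenvalue_list A = sorted_list_of_multiset (image_mset l (mset_set UNIV))"
proof -
  have "proots (\<Prod>i\<in>S. [:- l i, 1:]) = image_mset l (mset_set S)" if "finite S" for S
    using that
  proof induction
    case (insert x F)
    have "(\<Prod>i\<in>F. [:- l i, 1:]) \<noteq> 0" by (simp add: insert.hyps)
    then show ?case using insert by (simp add: proots_mult del: mult_pCons_left)
  qed simp
  then show ?thesis
    by (simp add: eigenvalue_list_def charpoly_eq_prod[OF assms])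
qed

text \<open>A count with multiplicity: the first two list entries lie below \<open>c\<close>, so at
  least two indices do. The indices are distinct even when their values agree.\<close>

lemma second_of_sorted_list_less:
  assumes "finite S" "card S \<ge> 2"
    and "sorted_list_of_multiset (image_mset l (mset_set S)) ! 1 < (c::real)"
  obtains i j where "i \<in> S" "j \<in> S" "i \<noteq> j" "l i < c" "l j < c"
proof -
  define xs where "xs = sorted_list_of_multiset (image_mset l (mset_set S))"
  have ms: "mset xs = image_mset l (mset_set S)" by (simp add: xs_def)
  then have len: "length xs \<ge> 2" using assms(2) by (metis size_image_mset size_mset size_mset_set)
  have "sorted xs" by (simp add: xs_def)
  then have "xs ! 0 \<le> xs ! 1" using len by (simp add: sorted_iff_nth_mono)
  then have lt: "xs ! 0 < c" "xs ! 1 < c" using assms(3) by (simp_all add: xs_def)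
  have "{0, 1} \<subseteq> {k. k < length xs \<and> xs ! k < c}"
    using lt len by auto
  then have "2 \<le> length (filter (\<lambda>x. x < c) xs)"
    unfolding length_filter_conv_card
    using card_mono[of "{k. k < length xs \<and> xs ! k < c}" "{0, 1}"] by simp
  also have "\<dots> = size (filter_mset (\<lambda>x. x < c) (mset xs))" by (metis mset_filter size_mset)
  also have "\<dots> = card {i \<in> S. l i < c}"
    by (simp add: ms filter_mset_image_mset filter_mset_mset_set assms(1))
  finally have "card {i \<in> S. l i < c} \<ge> 2" .
  then obtain T where T: "T \<subseteq> {i \<in> S. l i < c}" "card T = 2"
    by (rule obtain_subset_with_card_n)
  from T(2) obtain i j where "T = {i, j}" "i \<noteq> j" by (auto simp: card_2_iff)
  then show ?thesis using T(1) by (intro that[of i j]) auto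
qed

text \<open>The half of Courant-Fischer that is needed: a lower bound for the quadratic form on one hyperplane.\<close>

lemma second_eigenvalue_ge:
  fixes A :: "real ^ 'n ^ 'n"
  assumes sym: "transpose A = A" and card: "CARD('n) \<ge> 2"
    and bd: "\<And>x. a \<bullet> x = 0 \<Longrightarrow> c * (x \<bullet> x) \<le> x \<bullet> (A *v x)"
  shows "c \<le> eigenvalue_list A ! 1"
proof (rule ccontr)
  assume "\<not> ?thesis"
  then have less: "eigenvalue_list A ! 1 < c" by simp
  obtain b :: "'n \<Rightarrow> real ^ 'n" and l where bl: "\<forall>i j. b i \<bullet> b j = (if i = j then 1 else 0)" "\<forall>i. A *v b i = l i *\<^sub>R b i"
    using symmetric_matrix_orthonormal_eigenvectors[OF sym] by blast
  note on = bl(1)[rule_format] and ev = bl(2)[rule_format]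
  have "sorted_list_of_multiset (image_mset l (mset_set UNIV)) ! 1 < c"
    using less by (simp only: eigenvalue_list_eq[OF on ev])
  then obtain i j where ij: "i \<noteq> j" "l i < c" "l j < c"
    by (rule second_of_sorted_list_less[OF finite card])
  \<comment> \<open>The plane spanned by \<open>b i\<close> and \<open>b j\<close> meets the
    hyperplane orthogonal to \<open>a\<close> in a nonzero vector.\<close>
  obtain r s where rs: "r * (a \<bullet> b i) + s * (a \<bullet> b j) = 0" "r \<noteq> 0 \<or> s \<noteq> 0"
  proof (cases "a \<bullet> b i = 0")
    case True then show ?thesis using that[of 1 0] by simp
  next
    case False then show ?thesis using that[of "- (a \<bullet> b j)" "a \<bullet> b i"] by (simp add: mult.commute)
  qed
  define x where "x = r *\<^sub>R b i + s *\<^sub>R b j"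
  have "a \<bullet> x = 0" using rs by (simp add: x_def inner_add_right)
  from bd[OF this] have "c * (x \<bullet> x) \<le> x \<bullet> (A *v x)" .
  moreover have "x \<bullet> x = r\<^sup>2 + s\<^sup>2"
    using ij by (simp add: x_def inner_add_left inner_add_right on power2_eq_square)
  moreover have "A *v x = (r * l i) *\<^sub>R b i + (s * l j) *\<^sub>R b j"
    by (simp add: x_def matrix_vector_right_distrib matrix_vector_mult_scaleR ev)
  then have "x \<bullet> (A *v x) = l i * r\<^sup>2 + l j * s\<^sup>2"
    using ij by (simp add: x_def inner_add_left inner_add_right on power2_eq_square algebra_simps)
  \<comment> \<open>Both coefficients are positive, which forces \<open>r\<close> and
    \<open>s\<close> to be zero.\<close>
  ultimately have "(c - l i) * r\<^sup>2 + (c - l j) * s\<^sup>2 \<le> 0" by (simp add: algebra_simps)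
  moreover have "(c - l i) * r\<^sup>2 \<ge> 0" "(c - l j) * s\<^sup>2 \<ge> 0" using ij by simp_all
  ultimately have "(c - l i) * r\<^sup>2 = 0" "(c - l j) * s\<^sup>2 = 0" by linarith+
  then show False using ij rs by auto
qed

section \<open>Graph distance\<close>

lemma relpowp_symp:
  assumes "symp r" and "(r ^^ k) u v"
  shows "(r ^^ k) v u"
  using assms(2)
proof (induction k arbitrary: v)
  case (Suc k)
  then obtain w where "(r ^^ k) u w" "r w v" by auto
  then show ?case using Suc.IH assms(1) by (intro relpowp_Suc_I2[of r v w]) (auto dest: sympD)
qed simp

lemma graph_dist_le: "(adj ^^ k) u v \<Longrightarrow> graph_dist adj u v \<le> k"
  unfolding graph_dist_def by (rule Least_le)

lemma walk_of_graph_dist: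
  assumes "connected_graph adj"
  shows "(adj ^^ graph_dist adj u v) u v"
proof -
  have "\<exists>k. (adj ^^ k) u v"
    using assms by (simp add: connected_graph_def rtranclp_imp_relpowp)
  then show ?thesis unfolding graph_dist_def by (rule LeastI_ex)
qed

lemma graph_dist_sym:
  assumes "symp adj" "connected_graph adj"
  shows "graph_dist adj u v = graph_dist adj v u"
proof -
  have "graph_dist adj u v \<le> graph_dist adj v u" for u v
    by (rule graph_dist_le[OF relpowp_symp[OF assms(1) walk_of_graph_dist[OF assms(2)]]])
  then show ?thesis by (simp add: antisym)
qed

text \<open>Concatenate shortest walks through \<open>w\<close>.\<close>

lemma graph_dist_triangle:
  assumes "connected_graph adj"
  shows "graph_dist adj u v \<le> graph_dist adj u w + graph_dist adj w v"
  unfolding graph_dist_def[of adj u v]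
  using walk_of_graph_dist[OF assms, of u w] walk_of_graph_dist[OF assms, of w v]
  by (intro Least_le) (auto simp: relpowp_add)

text \<open>A walk of length 0 ends where it starts, so any second vertex has nonzero distance. This
  permits division by the square roots of transmissions.\<close>

lemma transmission_pos:
  fixes adj :: "'a::finite \<Rightarrow> 'a \<Rightarrow> bool"
  assumes "connected_graph adj" "CARD('a) \<ge> 2"
  shows "transmission adj u > 0"
proof -
  obtain v where "v \<noteq> u"
  proof (cases "UNIV = {u}")
    case True
    then have "CARD('a) = card {u}" by (rule arg_cong)
    then show ?thesis using assms(2) by simp
  next
    case False
    then show ?thesis using that by blast
  qed
  then have "graph_dist adj u v \<noteq> 0" using walk_of_graph_dist[OF assms(1), of u v] by (metis relpowp_0_E)
  then show ?thesis unfolding transmission_def by (intro sum_pos2[of UNIV v]) auto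
qed

section \<open>Entries of the Laplacian and the spectral gap bound\<close>

lemma diag_matrix_mult_left: "(diag_matrix f ** A) $ i $ j = f i * A $ i $ j"
  by (simp add: diag_matrix_def matrix_matrix_mult_def if_distribR if_distrib[of "\<lambda>x. x * _"] cong: if_cong)

lemma diag_matrix_mult_right: "(A ** diag_matrix f) $ i $ j = A $ i $ j * f j"
  by (simp add: diag_matrix_def matrix_matrix_mult_def if_distrib[of "\<lambda>x. _ * x"] cong: if_cong)

lemma normalized_distance_laplacian_entry:
  "normalized_distance_laplacian adj $ u $ v =
    ((if u = v then real (transmission adj u) else 0) - real (graph_dist adj u v))
      / (sqrt (transmission adj u) * sqrt (transmission adj v))"
  by (simp add: normalized_distance_laplacian_def transmission_inv_sqrt_def transmission_matrix_def
      distance_matrix_def diag_matrix_mult_left diag_matrix_mult_right)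
    (simp add: diag_matrix_def)

theorem theorem1p2:
  fixes adj :: "'a::finite \<Rightarrow> 'a \<Rightarrow> bool"
  assumes "simple_graph adj"
    and "connected_graph adj"
    and "CARD('a) \<ge> 2"
  shows "ndl_spectral_gap adj \<ge> (9 - 4 * sqrt 2) / 7"
proof -
  let ?N = "normalized_distance_laplacian adj"
  define t where "t u = real (transmission adj u)" for u
  define d where "d u v = real (graph_dist adj u v)" for u v
  have t: "t u > 0" for u using transmission_pos[OF assms(2,3)] by (simp add: t_def)
  have sym: "d u v = d v u" for u v
    using assms by (simp add: d_def graph_dist_sym simple_graph_def)
  have tri: "d u v \<le> d u w + d w v" for u v w
    using graph_dist_triangle[OF assms(2), of u v w] by (simp add: d_def flip: of_nat_add)
  have nn: "d u v \<ge> 0" for u v by (simp add: d_def)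
  have t_sum: "t u = (\<Sum>v\<in>UNIV. d u v)" for u by (simp add: t_def d_def transmission_def)
  have N: "?N $ u $ v = ((if u = v then t u else 0) - d u v) / (sqrt (t u) * sqrt (t v))" for u v
    by (simp add: normalized_distance_laplacian_entry t_def d_def)
  have "transpose ?N = ?N"
    by (simp add: vec_eq_iff transpose_def N sym mult.commute)
  \<comment> \<open>The kernel of \<open>?N\<close> contains the vector with entries
    \<open>sqrt (t u)\<close>, but the normal chosen here has the reciprocal entries: substituting
    \<open>x $ u = sqrt (t u) * f u\<close> then turns orthogonality into
    \<open>sum f UNIV = 0\<close>.\<close>
  moreover have "1 / 2 * (x \<bullet> x) \<le> x \<bullet> (?N *v x)"
    if x: "(\<chi> u. 1 / sqrt (t u)) \<bullet> x = 0" for x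
  proof -
    define f where "f u = x $ u / sqrt (t u)" for u
    have xf: "x $ u = sqrt (t u) * f u" for u using t[of u] by (simp add: f_def)
    have f0: "sum f UNIV = 0" using x by (simp add: inner_vec_def f_def)
    have "x $ u * x $ u = t u * (f u)\<^sup>2" for u
      using t[of u] by (simp add: xf power_mult_distrib flip: power2_eq_square)
    then have xx: "x \<bullet> x = (\<Sum>u\<in>UNIV. t u * (f u)\<^sup>2)"
      by (simp add: inner_vec_def)
    \<comment> \<open>The substitution undoes the normalization, leaving the form of the
      transmission matrix minus the distance matrix at \<open>f\<close>.\<close>
    have "?N $ u $ v * x $ u * x $ v = (if u = v then t u * (f u)\<^sup>2 else 0) - d u v * f u * f v" for u v
      using t[of u] t[of v] by (simp add: N xf field_simps power2_eq_square)
    then have "x \<bullet> (?N *v x) =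
        (\<Sum>u\<in>UNIV. \<Sum>v\<in>UNIV. (if u = v then t u * (f u)\<^sup>2 else 0) - d u v * f u * f v)"
      by (simp add: inner_vec_def matrix_vector_mult_def sum_distrib_left mult_ac)
    also have "\<dots> = x \<bullet> x - (\<Sum>u\<in>UNIV. \<Sum>v\<in>UNIV. d u v * f u * f v)"
      by (simp add: sum_subtractf xx)
    finally show ?thesis
      using metric_quadratic_form_le[of d, OF sym tri nn f0]
      by (simp add: xx flip: t_sum)
  qed
  ultimately have "1 / 2 \<le> ndl_spectral_gap adj"
    unfolding ndl_spectral_gap_def using assms(3) by (intro second_eigenvalue_ge) auto
  \<comment> \<open>The claimed constant is at most 1/2 exactly when \<open>sqrt 2\<close> is at
    least 11/8, and 121/64 is below 2.\<close>
  moreover have "11 / 8 \<le> sqrt 2" by (rule real_le_rsqrt) (simp add: power2_eq_square)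
  ultimately show ?thesis by simp
qed

end
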